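(* Let $G$ be a connected graph. (1) Suppose $\gamma(G)\le b$. If $\gamma_P(G)\ge\frac b2$, then $\operatorname{th}_{\rm pd}^{\times}(G)=\gamma(G)$. In particular, if $\gamma_P(G)\ge\frac{\gamma(G)}2$, then $\operatorname{th}_{\rm pd}^{\times}(G)=\gamma(G)$. (2) Suppose $\operatorname{th}_{\rm pd}^{\times}(G;S)=b<\gamma(G)$ for some $S\subset V(G)$. Then $\operatorname{th}_{\rm pd}^{\times}(G)=\operatorname{th}_{\rm pd}^{\times}(G,k)$ for some $k$ such that $\gamma_P(G)\le k\le\left\lfloor\frac b2\right\rfloor$.
   Context: All graphs are finite, simple and undirected with at least one vertex. Let $G$ be a graph. $\gamma(G)$ is the domination number: the minimum $|S|$ over $S\subseteq V(G)$ with $N[S]=V(G)$, where $N[S]$ is the closed neighborhood of $S$. For nonempty $S\subseteq V(G)$ define $P^{[0]}(S)=S$, $P^{[1]}(S)=N[S]$, and for $i\ge 1$, $P^{[i+1]}(S)=P^{[i]}(S)\cup\{w\in V(G)\setminus P^{[i]}(S): \exists u\in P^{[i]}(S),\ N(u)\setminus P^{[i]}(S)=\{w\}\}$. $S$ is a power dominating set if $P^{[t]}(S)=V(G)$ for some $t$; the power domination number $\gamma_P(G)$ is the minimum cardinality of a power dominating set. The power propagation time $\operatorname{pt}_{\rm pd}(G;S)$ is the least positive integer $t$ with $P^{[t]}(S)=V(G)$ (so it is at least $1$, even for $S=V(G)$), and is $\infty$ if $S$ is not a power dominating set. For nonempty $S\subseteq V(G)$, $\operatorname{th}_{\rm pd}^{\times}(G;S)=|S|\operatorname{pt}_{\rm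 pd}(G;S)$; for a positive integer $k$, $\operatorname{th}_{\rm pd}^{\times}(G,k)=\min_{|S|=k}\operatorname{th}_{\rm pd}^{\times}(G;S)$; and $\operatorname{th}_{\rm pd}^{\times}(G)=\min_{\emptyset\ne S\subseteq V(G)}\operatorname{th}_{\rm pd}^{\times}(G;S)$. *)

theory Defs
  imports
    Complex_Main
    "HOL-Library.Extended_Nat"
    "Graph_Theory.Digraph_Component"
begin

text \<open>
  A finite simple undirected graph is a \<open>pair_graph\<close>: a finite vertex set \<open>pverts G\<close> with a
  symmetric, irreflexive adjacency relation \<open>parcs G\<close>, so that each edge \<open>{u, v}\<close> is represented
  by the two arcs \<open>(u, v)\<close> and \<open>(v, u)\<close>.
\<close>

definition nbhd :: "'a pair_pre_digraph \<Rightarrow> 'a \<Rightarrow> 'a set" where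
  "nbhd G u = {v. (u, v) \<in> parcs G}"

definition closed_nbhd :: "'a pair_pre_digraph \<Rightarrow> 'a set \<Rightarrow> 'a set" where
  "closed_nbhd G S = S \<union> (\<Union>u\<in>S. nbhd G u)"

definition dominating_set :: "'a pair_pre_digraph \<Rightarrow> 'a set \<Rightarrow> bool" where
  "dominating_set G S \<longleftrightarrow> S \<subseteq> pverts G \<and> closed_nbhd G S = pverts G"

definition domination_number :: "'a pair_pre_digraph \<Rightarrow> nat" where
  "domination_number G = Min (card ` {S. dominating_set G S})"

text \<open>\<open>pd_step G S i\<close> is $P^{[i]}(S)$: one domination step followed by zero forcing steps.\<close>

fun pd_step :: "'a pair_pre_digraph \<Rightarrow> 'a set \<Rightarrow> nat \<Rightarrow> 'a set" where
  "pd_step G S 0 = S"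
| "pd_step G S (Suc 0) = closed_nbhd G S"
| "pd_step G S (Suc (Suc i)) =
     pd_step G S (Suc i) \<union>
     {w \<in> pverts G - pd_step G S (Suc i).
        \<exists>u \<in> pd_step G S (Suc i). nbhd G u - pd_step G S (Suc i) = {w}}"

definition power_dominating_set :: "'a pair_pre_digraph \<Rightarrow> 'a set \<Rightarrow> bool" where
  "power_dominating_set G S \<longleftrightarrow>
     S \<noteq> {} \<and> S \<subseteq> pverts G \<and> (\<exists>t. pd_step G S t = pverts G)"

definition power_domination_number :: "'a pair_pre_digraph \<Rightarrow> nat" where
  "power_domination_number G = Min (card ` {S. power_dominating_set G S})"

definition power_propagation_time :: "'a pair_pre_digraph \<Rightarrow> 'a set \<Rightarrow> enat" where
  "power_propagation_time G S =
     (if power_dominating_set G S then enat (LEAST t. 0 < t \<and> pd_step G S t = pverts G) else \<infinity>)"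

text \<open>
  The product throttling numbers. They are used only for nonempty \<open>S\<close> and for positive \<open>k\<close>; note
  that \<open>0 * \<infinity> = 0\<close> in \<open>enat\<close>. Every infimum over a nonempty family in \<open>enat\<close> is attained, hence
  is a minimum; for \<open>k\<close> larger than the number of vertices the family is empty and the value
  is \<open>\<infinity>\<close>.
\<close>

definition th_set :: "'a pair_pre_digraph \<Rightarrow> 'a set \<Rightarrow> enat" where
  "th_set G S = enat (card S) * power_propagation_time G S"

definition th_size :: "'a pair_pre_digraph \<Rightarrow> nat \<Rightarrow> enat" where
  "th_size G k = (INF S \<in> {S. S \<subseteq> pverts G \<and> card S = k}. th_set G S)"

definition th :: "'a pair_pre_digraph \<Rightarrow> enat" where
  "th G = (INF S \<in> {S. S \<noteq> {} \<and> S \<subseteq> pverts G}. th_set G S)"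

end

theory Submission
  imports Defs
begin

text \<open>
  A power dominating set with propagation time 1 is dominating, so it costs at least $\gamma(G)$;
  any other one costs at least twice its size, hence at least $2\gamma_P(G)$. A minimum dominating
  set costs exactly $\gamma(G)$. Both parts follow by comparing these bounds on an optimal set.
\<close>

text \<open>Arcs end in vertices. This serves two boundary cases: it gives a first dominating set,
  and it handles the start S = V(G), already complete at step 0.\<close>

lemma closed_nbhd_pverts:
  assumes "pair_graph G"
  shows "closed_nbhd G (pverts G) = pverts G"
proof -
  interpret pair_graph G by fact
  show ?thesis
    by (auto simp: closed_nbhd_def nbhd_def dest: in_arcsD2)
qed

lemma domination_number_le:
  assumes "finite (pverts G)" "dominating_set G S"
  shows "domination_number G \<le> card S"
proof -
  have "finite {S. dominating_set G S}"
    by (rule finite_subset[of _ "Pow (pverts G)"]) (use assms(1) in \<open>auto simp: dominating_set_def\<close>)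
  then show ?thesis
    unfolding domination_number_def using assms(2) by (intro Min_le) auto
qed

lemma ex_minimum_dominating_set:
  assumes "pair_graph G"
  obtains D where "dominating_set G D" "card D = domination_number G"
proof -
  interpret pair_graph G by fact
  have "finite {S. dominating_set G S}"
    by (rule finite_subset[of _ "Pow (pverts G)"]) (auto simp: dominating_set_def)
  \<comment> \<open>\<open>Min\<close> is attained only on a nonempty finite set; the whole vertex
    set is the witness.\<close>
  moreover have "dominating_set G (pverts G)"
    using closed_nbhd_pverts[OF assms] by (simp add: dominating_set_def)
  ultimately have "domination_number G \<in> card ` {S. dominating_set G S}"
    unfolding domination_number_def by (intro Min_in) auto
  then show ?thesis using that by auto
qed

lemma power_domination_number_le:
  assumes "finite (pverts G)" "power_dominating_set G S"
  shows "power_domination_number G \<le> card S"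
proof -
  have "finite {S. power_dominating_set G S}"
    by (rule finite_subset[of _ "Pow (pverts G)"])
      (use assms(1) in \<open>auto simp: power_dominating_set_def\<close>)
  then show ?thesis
    unfolding power_domination_number_def using assms(2) by (intro Min_le) auto
qed

lemma power_propagation_time_cases:
  assumes "pair_graph G" "power_dominating_set G S"
  obtains "dominating_set G S" "power_propagation_time G S = 1"
  | "power_propagation_time G S \<ge> 2"
proof -
  let ?P = "\<lambda>t. 0 < t \<and> pd_step G S t = pverts G"
  obtain t where t: "pd_step G S t = pverts G"
    using assms(2) by (auto simp: power_dominating_set_def)
  \<comment> \<open>\<open>power_dominating_set\<close> admits t = 0, but the propagation time
    counts positive t only. If t = 0 then S is all of V(G), and step 1 still gives V(G).\<close>
  have "\<exists>t. ?P t"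
  proof (cases "t = 0")
    case True
    with t closed_nbhd_pverts[OF assms(1)] have "?P (Suc 0)" by simp
    then show ?thesis by blast
  qed (use t in blast)
  then have P: "?P (LEAST t. ?P t)" by (rule LeastI_ex)
  have time: "power_propagation_time G S = enat (LEAST t. ?P t)"
    using assms(2) by (simp add: power_propagation_time_def)
  show ?thesis
  proof (cases "(LEAST t. ?P t) = Suc 0")
    case True
    with P have "closed_nbhd G S = pverts G" by simp
    with True assms(2) time that(1) show ?thesis
      by (simp add: dominating_set_def power_dominating_set_def one_enat_def)
  next
    case False
    with P have "(LEAST t. ?P t) \<ge> 2" by linarith
    then show ?thesis using time that(2) by (simp add: numeral_eq_enat)
  qed
qed

lemma th_set_dominating:
  assumes "dominating_set G D" "D \<noteq> {}"
  shows "th_set G D = enat (card D)"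
proof -
  have 1: "pd_step G D (Suc 0) = pverts G"
    using assms(1) by (simp add: dominating_set_def)
  with assms have "power_dominating_set G D"
    unfolding power_dominating_set_def dominating_set_def by blast
  moreover have "(LEAST t. 0 < t \<and> pd_step G D t = pverts G) = Suc 0"
    using 1 by (intro Least_equality) auto
  ultimately show ?thesis
    by (simp add: th_set_def power_propagation_time_def)
qed

lemma th_le_domination_number:
  assumes "pair_graph G" "pverts G \<noteq> {}"
  shows "th G \<le> enat (domination_number G)"
proof -
  obtain D where D: "dominating_set G D" "card D = domination_number G"
    using ex_minimum_dominating_set[OF assms(1)] .
  \<comment> \<open>The empty set has empty closed neighborhood, so it cannot dominate a nonempty
    graph.\<close>
  then have "D \<noteq> {}" "D \<subseteq> pverts G"
    using assms(2) by (auto simp: dominating_set_def closed_nbhd_def)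
  then have "th G \<le> th_set G D" unfolding th_def by (intro INF_lower) auto
  then show ?thesis using th_set_dominating \<open>D \<noteq> {}\<close> D by metis
qed

lemma ex_optimal_set:
  assumes "pverts G \<noteq> {}"
  obtains S where "S \<noteq> {}" "S \<subseteq> pverts G" "th G = th_set G S"
proof -
  have "th_set G (pverts G) \<in> th_set G ` {S. S \<noteq> {} \<and> S \<subseteq> pverts G}"
    using assms by blast
  \<comment> \<open>By well-ordering, the infimum of a nonempty set in \<open>enat\<close> is its
    \<open>LEAST\<close> element, hence a member.\<close>
  then have "th G \<in> th_set G ` {S. S \<noteq> {} \<and> S \<subseteq> pverts G}"
    unfolding th_def Inf_enat_def using LeastI by (metis (no_types, lifting) empty_iff)
  then show ?thesis using that by auto
qed

text \<open>The dichotomy behind both parts, split by propagation time: 1 or \<infinity> leads to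
  the first alternative, any other value to the second.\<close>

lemma th_set_cases:
  assumes "pair_graph G" "S \<noteq> {}" "S \<subseteq> pverts G"
  obtains "enat (domination_number G) \<le> th_set G S"
  | "power_domination_number G \<le> card S" "enat (2 * card S) \<le> th_set G S"
proof -
  interpret pair_graph G by fact
  have "finite S" using assms(3) finite_verts by (simp add: finite_subset)
  show ?thesis
  proof (cases "power_dominating_set G S")
    case False
    \<comment> \<open>Finiteness and nonemptiness make \<open>card S\<close> nonzero, which avoids 0
      * \<infinity> = 0.\<close>
    with \<open>finite S\<close> \<open>S \<noteq> {}\<close> have "th_set G S = \<infinity>"
      by (simp add: th_set_def power_propagation_time_def enat_0_iff)
    then show ?thesis using that(1) by simp
  next
    case True
    show ?thesis
    proof (cases rule: power_propagation_time_cases[OF assms(1) True])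
      case 1
      then show ?thesis
        using that(1) domination_number_le[of G S] by (simp add: th_set_def)
    next
      case 2
      have "enat (2 * card S) = enat (card S) * 2" by (simp add: numeral_eq_enat)
      also have "\<dots> \<le> th_set G S"
        unfolding th_set_def using 2 by (intro mult_left_mono) auto
      finally show ?thesis
        using that(2) power_domination_number_le[OF _ True] by simp
    qed
  qed
qed

lemma th_eq_domination_number:
  assumes "pair_graph G" "pverts G \<noteq> {}" "domination_number G \<le> 2 * power_domination_number G"
  shows "th G = enat (domination_number G)"
proof (rule antisym)
  obtain S where S: "S \<noteq> {}" "S \<subseteq> pverts G" "th G = th_set G S"
    using ex_optimal_set[OF assms(2)] .
  show "enat (domination_number G) \<le> th G"
  proof (cases rule: th_set_cases[OF assms(1) S(1,2)])
    case 2
    \<comment> \<open>The hypothesis chains with the size bound: \<gamma>(G) \<le> 2 \<gamma>_P(G)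
      \<le> 2|S|.\<close>
    have "enat (domination_number G) \<le> enat (2 * card S)"
      using assms(3) 2(1) by simp
    with 2(2) S(3) show ?thesis using order_trans by metis
  qed (simp add: S)
qed (rule th_le_domination_number[OF assms(1,2)])

text \<open>An optimal set costs less than \<gamma>(G), so only the second alternative of
  \<open>th_set_cases\<close> is left for it. Its size serves as k.\<close>

lemma th_eq_th_size:
  assumes "pair_graph G" "pverts G \<noteq> {}" "th G \<le> enat b" "b < domination_number G"
  obtains k where "power_domination_number G \<le> k" "2 * k \<le> b" "th G = th_size G k"
proof -
  interpret pair_graph G by fact
  obtain S where S: "S \<noteq> {}" "S \<subseteq> pverts G" "th G = th_set G S"
    using ex_optimal_set[OF assms(2)] .
  have "th G < enat (domination_number G)"
    using assms(3,4) by (meson enat_ord_simps(2) le_less_trans)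
  then have k: "power_domination_number G \<le> card S" "enat (2 * card S) \<le> th_set G S"
    using th_set_cases[OF assms(1) S(1,2)] S(3) by (metis not_le)+
  have "2 * card S \<le> b"
    using k(2) S(3) assms(3) by (metis enat_ord_simps(1) order_trans)
  moreover have "card S > 0"
    using S(1,2) finite_verts by (auto simp: card_gt_0_iff intro: finite_subset)
  \<comment> \<open>Sets of positive size are nonempty, so the family for \<open>th_size\<close>
    lies inside the one for \<open>th\<close>, and its infimum is no smaller.\<close>
  then have "th G \<le> th_size G (card S)"
    unfolding th_def th_size_def by (intro INF_superset_mono) auto
  moreover have "th_size G (card S) \<le> th_set G S"
    unfolding th_size_def using S(2) by (intro INF_lower) auto
  ultimately show ?thesis using that k(1) S(3) by simp
qed

theorem proposition3p8:
  fixes G :: "'a pair_pre_digraph"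
  assumes "pair_graph G"
    and "Digraph_Component.connected (with_proj G)"
  shows "(\<forall>b::real. real (domination_number G) \<le> b \<and> real (power_domination_number G) \<ge> b / 2
            \<longrightarrow> th G = enat (domination_number G))
       \<and> (real (power_domination_number G) \<ge> real (domination_number G) / 2
            \<longrightarrow> th G = enat (domination_number G))
       \<and> (\<forall>(S::'a set) (b::nat).
            S \<noteq> {} \<and> S \<subseteq> pverts G \<and> th_set G S = enat b \<and> b < domination_number G
            \<longrightarrow> (\<exists>k::nat. power_domination_number G \<le> k \<and> int k \<le> \<lfloor>real b / 2\<rfloor>
                  \<and> th G = th_size G k))"
proof -
  \<comment> \<open>Nonemptiness of the vertex set is built into
    \<open>strongly_connected\<close>.\<close>
  have ne: "pverts G \<noteq> {}"
    using assms(2) by (auto simp: connected_def strongly_connected_def)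
  have part1: "th G = enat (domination_number G)"
    if "real (domination_number G) \<le> b" "real (power_domination_number G) \<ge> b / 2" for b
  proof (rule th_eq_domination_number[OF assms(1) ne])
    show "domination_number G \<le> 2 * power_domination_number G"
      using that by linarith
  qed
  have part2: "\<exists>k. power_domination_number G \<le> k \<and> int k \<le> \<lfloor>real b / 2\<rfloor> \<and> th G = th_size G k"
    if S: "S \<noteq> {}" "S \<subseteq> pverts G" "th_set G S = enat b" and b: "b < domination_number G" for S b
  proof -
    have "th G \<le> enat b"
      unfolding th_def using S by (intro INF_lower2[of S]) auto
    then obtain k where k: "power_domination_number G \<le> k" "2 * k \<le> b" "th G = th_size G k"
      using th_eq_th_size[OF assms(1) ne _ b] by blast
    from k(2) have "int k \<le> \<lfloor>real b / 2\<rfloor>" by linarith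
    with k show ?thesis by blast
  qed
  \<comment> \<open>The middle conjunct is \<open>part1\<close> with b = \<gamma>(G).\<close>
  show ?thesis using part1 part2 by blast
qed

end
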